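(* Let $B=5$, let $\tilde p>0$ be an integer and $\tilde q$ a positive integer with $\tilde q\geqslant 3600\sqrt[3]{|\tilde p|}$ and $2\tilde q>\tilde p$. Let $F_1=B^{2}\tilde q^{6}+2B\tilde q^{4}-2B\tilde p\tilde q^{3}-2\tilde q^{2}-2\tilde p\tilde q+\tilde p^{2}+\frac5B-\frac{20}{B^{2}\tilde q^{2}}$. Then there is no integer $t$ with $F_1<t<F_1+\frac{10\tilde p}{B^{2}\tilde q^{3}}$. *)

theory Defs
  imports Complex_Main
begin

definition F1 :: "real \<Rightarrow> int \<Rightarrow> int \<Rightarrow> real" where
  "F1 B p q =
     B ^ 2 * of_int q ^ 6 + 2 * B * of_int q ^ 4 - 2 * B * of_int p * of_int q ^ 3
     - 2 * of_int q ^ 2 - 2 * of_int p * of_int q + of_int p ^ 2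
     + 5 / B - 20 / (B ^ 2 * of_int q ^ 2)"

end

theory Submission
  imports Defs
begin

text \<open>At \<open>B = 5\<close> the term \<open>5 / B\<close> becomes the integer 1, so the last
  term is the only one left with a denominator, and 20/25 reduces to 4/5.\<close>

lemma F1_5_eq:
  fixes p q :: int
  shows "F1 5 p q = of_int (25 * q ^ 6 + 10 * q ^ 4 - 10 * p * q ^ 3 - 2 * q ^ 2 - 2 * p * q + p ^ 2 + 1)
           - 4 / (5 * of_int q ^ 2)"
  by (simp add: F1_def)

text \<open>
  For \<open>B = 5\<close> the value \<open>F1 B p q\<close> is an integer minus \<open>4 / (5 q\<^sup>2) < 1\<close>, and \<open>p < 2 q\<close> makes
  the length \<open>2 p / (5 q\<^sup>3)\<close> of the interval smaller than this defect, so the interval lies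
  strictly between two consecutive integers.
\<close>

theorem theorem7p3:
  fixes B :: real and p q :: int
  assumes "B = 5"
    and "p > 0"
    and "q > 0"
    and "of_int q \<ge> 3600 * root 3 \<bar>of_int p\<bar>"
    and "2 * q > p"
  shows "\<not> (\<exists>t::int. F1 B p q < of_int t \<and>
           of_int t < F1 B p q + 10 * of_int p / (B ^ 2 * of_int q ^ 3))"
proof
  define N where "N = 25 * q ^ 6 + 10 * q ^ 4 - 10 * p * q ^ 3 - 2 * q ^ 2 - 2 * p * q + p ^ 2 + 1"
  have F1: "F1 B p q = of_int N - 4 / (5 * of_int q ^ 2)"
    using F1_5_eq \<open>B = 5\<close> N_def by simp
  have q: "(of_int q :: real) \<ge> 1"
    using \<open>q > 0\<close> by simp
  then have "(of_int q :: real) ^ 2 \<ge> 1"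
    by (rule one_le_power)
  then have defect: "4 / (5 * of_int q ^ 2) < (1 :: real)"
    by (simp add: divide_less_eq)
  have "(of_int p :: real) < 2 * of_int q"
    using \<open>2 * q > p\<close> by linarith
  \<comment> \<open>At \<open>p = 2 * q\<close> the interval length would equal the defect exactly,
    so the strict inequality carries over.\<close>
  then have "10 * of_int p / (25 * of_int q ^ 3) < 10 * (2 * of_int q) / (25 * of_int q ^ 3 :: real)"
    using q by (intro divide_strict_right_mono) auto
  also have "\<dots> = 4 / (5 * of_int q ^ 2)"
    using q by (simp add: power2_eq_square power3_eq_cube)
  finally have length: "10 * of_int p / (B ^ 2 * of_int q ^ 3) < 4 / (5 * of_int q ^ 2)"
    using \<open>B = 5\<close> by simp
  assume "\<exists>t::int. F1 B p q < of_int t \<and>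
           of_int t < F1 B p q + 10 * of_int p / (B ^ 2 * of_int q ^ 3)"
  then obtain t :: int where
    t: "F1 B p q < of_int t" "of_int t < F1 B p q + 10 * of_int p / (B ^ 2 * of_int q ^ 3)"
    by blast
  \<comment> \<open>\<open>defect\<close> keeps the left end above \<open>N - 1\<close>;
    \<open>length\<close> keeps the right end below \<open>N\<close>.\<close>
  have "real_of_int (N - 1) < of_int t" "real_of_int t < of_int N"
    using t F1 defect length by simp_all
  then show False
    unfolding of_int_less_iff by linarith
qed

end
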